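(* Let $A_1=P_1-R_1+S_1$ and $A_2=P_2-R_2+S_2$ be convergent double weak splittings of type II of the nonsingular symmetric matrices $A_1\in\mathbb{R}^{n\times n}$ and $A_2\in\mathbb{R}^{n\times n}$, respectively, and for $i=1,2$ let $$\widetilde{\mathbf{W}}_i=\begin{pmatrix}(R_iP_i^{-1})^T & -(S_iP_i^{-1})^T\\ I & 0\end{pmatrix}.$$ If $R_1P_1^{-1}\ge R_2P_2^{-1}$ and $A_1P_1^{-1}\ge A_2P_2^{-1}$, then $\rho(\widetilde{\mathbf{W}}_1)\le\rho(\widetilde{\mathbf{W}}_2)<1$.
   Context: Matrix inequalities are entrywise; $\rho$ is the spectral radius; $I$ is the $n\times n$ identity. For a symmetric nonsingular matrix $A\in\mathbb{R}^{n\times n}$, a decomposition $A=P-R+S$ with $P$ nonsingular is a double weak splitting of type II if $RP^{-1}\ge 0$ and $-SP^{-1}\ge 0$. It is convergent if its iteration matrix $\begin{pmatrix}(RP^{-1})^T & -(SP^{-1})^T\\ I & 0\end{pmatrix}$ has spectral radius less than $1$. *)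

theory Defs
  imports
    "Jordan_Normal_Form.Gauss_Jordan_Elimination"
    "Jordan_Normal_Form.Spectral_Radius"
begin

text \<open>
  The library function \<^const>\<open>mat_inverse\<close> returns an option value; \<open>inverse_mat P\<close> is the inverse of
  a square matrix \<open>P\<close> whenever \<open>P\<close> is invertible, and an arbitrary value otherwise.
\<close>

definition inverse_mat :: "real mat \<Rightarrow> real mat" where
  "inverse_mat P = the (mat_inverse P)"

lemma inverse_mat:
  assumes P: "P \<in> carrier_mat n n" and inv: "invertible_mat P"
  shows "inverse_mat P \<in> carrier_mat n n"
    and "P * inverse_mat P = 1\<^sub>m n"
    and "inverse_mat P * P = 1\<^sub>m n"
proof -
  from inv obtain B where PB: "P * B = 1\<^sub>m n" and BP: "B * P = 1\<^sub>m (dim_row B)"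
    using P unfolding invertible_mat_def inverts_mat_def by auto
  have "dim_col B = n"
    using arg_cong[OF PB, of dim_col] by simp
  moreover have "dim_row B = n"
    using arg_cong[OF BP, of dim_col] P by simp
  ultimately have B: "B \<in> carrier_mat n n" by auto
  have "P \<in> Units (ring_mat TYPE(real) n ())"
    using P B PB BP unfolding Units_def ring_mat_def by auto
  then have "mat_inverse P \<noteq> None"
    using mat_inverse(1)[OF P, where b = "()"] by blast
  then have "mat_inverse P = Some (inverse_mat P)"
    by (simp add: inverse_mat_def)
  from mat_inverse(2)[OF P this]
  show "inverse_mat P \<in> carrier_mat n n"
    and "P * inverse_mat P = 1\<^sub>m n"
    and "inverse_mat P * P = 1\<^sub>m n"
    by auto
qed

definition symmetric_mat :: "'a mat \<Rightarrow> bool" where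
  "symmetric_mat A \<longleftrightarrow> A\<^sup>T = A"

text \<open>
  The spectral radius of a real matrix ranges over all its complex eigenvalues.
\<close>

definition real_spectral_radius :: "real mat \<Rightarrow> real" where
  "real_spectral_radius A = spectral_radius (map_mat complex_of_real A)"

text \<open>
  The library order \<open>\<le>\<close> on matrices is the entrywise one and includes equality of dimensions.
\<close>

definition double_weak_splitting_II ::
  "nat \<Rightarrow> real mat \<Rightarrow> real mat \<Rightarrow> real mat \<Rightarrow> real mat \<Rightarrow> bool" where
  "double_weak_splitting_II n A P R S \<longleftrightarrow>
     P \<in> carrier_mat n n \<and> R \<in> carrier_mat n n \<and> S \<in> carrier_mat n n \<and>
     A = P - R + S \<and> invertible_mat P \<and>
     0\<^sub>m n n \<le> R * inverse_mat P \<and>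
     0\<^sub>m n n \<le> - (S * inverse_mat P)"

definition double_iteration_mat ::
  "nat \<Rightarrow> real mat \<Rightarrow> real mat \<Rightarrow> real mat \<Rightarrow> real mat" where
  "double_iteration_mat n P R S =
     four_block_mat ((R * inverse_mat P)\<^sup>T) (- (S * inverse_mat P)\<^sup>T)
                    (1\<^sub>m n)                 (0\<^sub>m n n)"

definition convergent_double_weak_splitting_II ::
  "nat \<Rightarrow> real mat \<Rightarrow> real mat \<Rightarrow> real mat \<Rightarrow> real mat \<Rightarrow> bool" where
  "convergent_double_weak_splitting_II n A P R S \<longleftrightarrow>
     double_weak_splitting_II n A P R S \<and>
     real_spectral_radius (double_iteration_mat n P R S) < 1"

end

theory Submission
  imports Defs
begin

text \<open>
  Write \<open>B\<^sub>i = (R\<^sub>i P\<^sub>i\<^sup>-\<^sup>1)\<^sup>T\<close> and \<open>C\<^sub>i = - (S\<^sub>i P\<^sub>i\<^sup>-\<^sup>1)\<^sup>T\<close>; the hypotheses say that these matrices are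
  nonnegative with \<open>B\<^sub>1 \<ge> B\<^sub>2\<close> and \<open>B\<^sub>1 + C\<^sub>1 \<le> B\<^sub>2 + C\<^sub>2\<close>, hence \<open>\<mu> B\<^sub>1 + C\<^sub>1 \<le> \<mu> B\<^sub>2 + C\<^sub>2\<close> for
  \<open>0 \<le> \<mu> \<le> 1\<close>. For \<open>\<rho>(W\<^sub>2) < \<mu> < 1\<close> there is a positive vector \<open>(u\<^sub>1, u\<^sub>2)\<close> with
  \<open>W\<^sub>2 (u\<^sub>1, u\<^sub>2) \<le> \<mu> (u\<^sub>1, u\<^sub>2)\<close>. Eliminating \<open>u\<^sub>2\<close> gives \<open>(\<mu> B\<^sub>2 + C\<^sub>2) u\<^sub>1 \<le> \<mu>\<^sup>2 u\<^sub>1\<close>, so the same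
  bound holds with index 1, that is \<open>W\<^sub>1 (\<mu> u\<^sub>1, u\<^sub>1) \<le> \<mu> (\<mu> u\<^sub>1, u\<^sub>1)\<close>. A positive vector with this
  property forces \<open>\<rho>(W\<^sub>1) \<le> \<mu>\<close>.
\<close>

section \<open>Eigenvalues, scaling and the growth of matrix powers\<close>

text \<open>In dimension 0 the spectrum is empty and its maximum modulus is unspecified, so the
  radii can be compared only because the matrices themselves coincide.\<close>

lemma real_spectral_radius_cong_0:
  fixes A B :: "real mat"
  assumes "A \<in> carrier_mat 0 0" "B \<in> carrier_mat 0 0"
  shows "real_spectral_radius A = real_spectral_radius B"
proof -
  have "A = B" using assms by (intro eq_matI) auto
  then show ?thesis by simp
qed

lemma eigenvector_index:
  assumes A: "A \<in> carrier_mat n n" and ev: "eigenvector A v k" and i: "i < n"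
  shows "(\<Sum>j<n. A $$ (i,j) * v $ j) = k * v $ i"
proof -
  have v: "v \<in> carrier_vec n" and eq: "A *\<^sub>v v = k \<cdot>\<^sub>v v"
    using ev A unfolding eigenvector_def by auto
  have "(A *\<^sub>v v) $ i = (\<Sum>j<n. A $$ (i,j) * v $ j)"
    using A v i by (simp add: scalar_prod_def atLeast0LessThan)
  with eq v i show ?thesis by simp
qed

text \<open>An eigenvalue \<open>k\<close> of \<open>A\<close> scaled by \<open>1 / \<nu>\<close>
  makes \<open>\<nu> * k\<close> an eigenvalue of \<open>A\<close> with the same eigenvector. The
  scaling reduces power bounds to the case of spectral radius below 1.\<close>

lemma spectral_radius_less_scaled:
  assumes A: "A \<in> carrier_mat n n" and n: "n > 0"
    and \<nu>: "\<nu> > 0" "spectral_radius A < \<nu>"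
  shows "spectral_radius (complex_of_real (1 / \<nu>) \<cdot>\<^sub>m A) < 1"
proof -
  let ?K = "complex_of_real (1 / \<nu>) \<cdot>\<^sub>m A"
  have K: "?K \<in> carrier_mat n n" using A by simp
  obtain k where k: "eigenvalue ?K k" and sr: "spectral_radius ?K = norm k"
    using spectral_radius_mem_max(1)[OF K n] unfolding spectrum_def by auto
  obtain v where v: "eigenvector ?K v k" using k unfolding eigenvalue_def by auto
  have vn: "v \<in> carrier_vec n" "v \<noteq> 0\<^sub>v n" using v K unfolding eigenvector_def by auto
  have "A *\<^sub>v v = (of_real \<nu> * k) \<cdot>\<^sub>v v"
  proof (rule eq_vecI)
    fix i assume "i < dim_vec ((of_real \<nu> * k) \<cdot>\<^sub>v v)"
    then have i: "i < n" using vn by simp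
    have "(\<Sum>j<n. ?K $$ (i,j) * v $ j) = k * v $ i" by (rule eigenvector_index[OF K v i])
    moreover have "(\<Sum>j<n. ?K $$ (i,j) * v $ j) = of_real (1 / \<nu>) * (\<Sum>j<n. A $$ (i,j) * v $ j)"
      unfolding sum_distrib_left using A i by (intro sum.cong) auto
    ultimately have "(\<Sum>j<n. A $$ (i,j) * v $ j) = of_real \<nu> * k * v $ i"
      using \<nu>(1) by (simp add: field_simps)
    then show "(A *\<^sub>v v) $ i = ((of_real \<nu> * k) \<cdot>\<^sub>v v) $ i"
      using A vn i by (simp add: scalar_prod_def atLeast0LessThan)
  qed (use A vn in auto)
  then have "eigenvalue A (of_real \<nu> * k)"
    using A vn unfolding eigenvalue_def eigenvector_def by auto
  then have "norm (of_real \<nu> * k) \<le> spectral_radius A"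
    by (intro spectral_radius_mem_max(2)[OF A n]) (auto simp: spectrum_def)
  then have "\<nu> * norm k \<le> spectral_radius A" using \<nu>(1) by (simp add: norm_mult)
  then have "\<nu> * norm k < \<nu> * 1" using \<nu>(2) by linarith
  then have "norm k < 1" using \<nu>(1) by (simp only: mult_less_cancel_left_pos)
  then show ?thesis unfolding sr .
qed

lemma pow_smult_mat:
  fixes A :: "'a :: comm_semiring_1 mat"
  assumes A: "A \<in> carrier_mat n n"
  shows "(a \<cdot>\<^sub>m A) ^\<^sub>m k = a ^ k \<cdot>\<^sub>m A ^\<^sub>m k"
proof (induction k)
  case 0
  then show ?case using A by (intro eq_matI) auto
next
  case (Suc k)
  have "A ^\<^sub>m k \<in> carrier_mat n n" using A by simp
  with Suc A show ?case
    by (intro eq_matI) (auto simp: scalar_prod_def sum_distrib_left ac_simps)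
qed

lemma pow_mat_Suc_left:
  fixes A :: "'a :: semiring_1 mat"
  assumes A: "A \<in> carrier_mat n n"
  shows "A ^\<^sub>m Suc k = A * A ^\<^sub>m k"
proof (induction k)
  case (Suc k)
  have "A ^\<^sub>m Suc (Suc k) = (A * A ^\<^sub>m k) * A" using Suc by simp
  also have "\<dots> = A * A ^\<^sub>m Suc k" using A by (simp add: assoc_mult_mat[of A n n _ n _ n])
  finally show ?case .
qed (use A in simp)

text \<open>The powers of W/\<nu>, viewed as a complex matrix of spectral radius below 1, are
  bounded by one constant for all exponents; multiplying back by \<open>\<nu> ^ k\<close> gives the
  claim.\<close>

lemma real_pow_mat_bound:
  fixes W :: "real mat"
  assumes W: "W \<in> carrier_mat m m" and m: "m > 0"
    and \<nu>: "\<nu> > 0" "real_spectral_radius W < \<nu>"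
  obtains c where "\<And>k i j. i < m \<Longrightarrow> j < m \<Longrightarrow> \<bar>(W ^\<^sub>m k) $$ (i,j)\<bar> \<le> c * \<nu> ^ k"
proof -
  let ?V = "map_mat complex_of_real W"
  let ?K = "complex_of_real (1 / \<nu>) \<cdot>\<^sub>m ?V"
  have V: "?V \<in> carrier_mat m m" and K: "?K \<in> carrier_mat m m" using W by auto
  have "spectral_radius ?K < 1"
    using spectral_radius_less_scaled[OF V m \<nu>(1)] \<nu>(2) by (simp add: real_spectral_radius_def)
  then obtain c where c: "norm_bound (?K ^\<^sub>m k) c" for k
    using spectral_radius_jnf_norm_bound_less_1_upper_triangular[OF K] by blast
  show thesis
  proof
    fix k i j assume ij: "i < m" "j < m"
    have "?K ^\<^sub>m k = complex_of_real (1 / \<nu>) ^ k \<cdot>\<^sub>m map_mat complex_of_real (W ^\<^sub>m k)"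
      unfolding pow_smult_mat[OF V] of_real_hom.mat_hom_pow[OF W] ..
    then have "(?K ^\<^sub>m k) $$ (i,j) = of_real ((W ^\<^sub>m k) $$ (i,j) / \<nu> ^ k)"
      using W ij by (simp add: power_divide)
    moreover have "norm ((?K ^\<^sub>m k) $$ (i,j)) \<le> c"
      using c[of k] pow_carrier_mat[OF K, of k] ij unfolding norm_bound_def by blast
    ultimately have "\<bar>(W ^\<^sub>m k) $$ (i,j)\<bar> / \<nu> ^ k \<le> c"
      using \<nu>(1) by (simp add: norm_divide norm_power)
    then show "\<bar>(W ^\<^sub>m k) $$ (i,j)\<bar> \<le> c * \<nu> ^ k"
      using \<nu>(1) by (simp add: divide_le_eq)
  qed
qed

section \<open>Positive subinvariant vectors and the spectral radius\<close>

lemma spectral_radius_nonneg: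
  assumes "A \<in> carrier_mat n n" "n > 0"
  shows "spectral_radius A \<ge> 0"
  using spectral_radius_mem_max(1)[OF assms] by auto

text \<open>
  The witness is the truncated Neumann series \<open>\<Sum>k<N. (W/\<mu>)\<^sup>k 1\<close>, where \<open>N\<close> is so large
  that \<open>(W/\<mu>)\<^sup>N 1 \<le> 1\<close>.
\<close>

lemma positive_subinvariant_vector_exists:
  fixes W :: "real mat"
  assumes W: "W \<in> carrier_mat m m" and m: "m > 0"
    and nonneg: "\<And>i j. i < m \<Longrightarrow> j < m \<Longrightarrow> W $$ (i,j) \<ge> 0"
    and less: "real_spectral_radius W < \<mu>"
  obtains u where "\<And>i. i < m \<Longrightarrow> u i > 0"
    and "\<And>i. i < m \<Longrightarrow> (\<Sum>j<m. W $$ (i,j) * u j) \<le> \<mu> * u i"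
proof -
  have sr: "real_spectral_radius W \<ge> 0"
    unfolding real_spectral_radius_def using W m by (intro spectral_radius_nonneg[of _ m]) auto
  \<comment> \<open>Entries of the k-th power grow at most like \<open>\<nu> ^ k\<close>; the gap
    between \<nu> and \<mu> makes the quotient by \<open>\<mu> ^ k\<close> tend to 0.\<close>
  obtain \<nu> where \<nu>: "real_spectral_radius W < \<nu>" "\<nu> < \<mu>" using dense less by blast
  have pos: "\<nu> > 0" "\<mu> > 0" using sr \<nu> by auto
  obtain c where c: "\<bar>(W ^\<^sub>m k) $$ (i,j)\<bar> \<le> c * \<nu> ^ k" if "i < m" "j < m" for k i j
    using real_pow_mat_bound[OF W m pos(1) \<nu>(1)] by blast
  \<comment> \<open>\<open>x k\<close> is the vector of row sums of the k-th power, that is, this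
    power applied to the all-ones vector.\<close>
  define x where "x k i = (\<Sum>j<m. (W ^\<^sub>m k) $$ (i,j))" for k i
  have x0: "x 0 i = 1" if "i < m" for i
    using W that by (simp add: x_def)
  have xSuc: "x (Suc k) i = (\<Sum>j<m. W $$ (i,j) * x k j)" if "i < m" for k i
  proof -
    have Wk: "W ^\<^sub>m k \<in> carrier_mat m m" using W by simp
    have "W ^\<^sub>m Suc k = W * W ^\<^sub>m k"
      by (rule pow_mat_Suc_left[OF W])
    then have "x (Suc k) i = (\<Sum>l<m. \<Sum>j<m. W $$ (i,j) * (W ^\<^sub>m k) $$ (j,l))"
      using W Wk that by (simp add: x_def scalar_prod_def atLeast0LessThan)
    then show ?thesis
      unfolding x_def sum_distrib_left by (subst sum.swap) simp
  qed
  have x_nonneg: "x k i \<ge> 0" if "i < m" for k i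
    using that
  proof (induction k arbitrary: i)
    case (Suc k)
    then show ?case unfolding xSuc[OF Suc.prems] by (intro sum_nonneg mult_nonneg_nonneg nonneg) auto
  qed (simp add: x0)
  have "(\<lambda>k. of_nat m * c * (\<nu> / \<mu>) ^ k) \<longlonglongrightarrow> of_nat m * c * 0"
    using \<nu> pos by (intro tendsto_mult_left LIMSEQ_power_zero) simp
  then have "eventually (\<lambda>k. of_nat m * c * (\<nu> / \<mu>) ^ k < 1) sequentially"
    by (intro order_tendstoD(2)) auto
  then obtain N0 where "\<And>N. N \<ge> N0 \<Longrightarrow> of_nat m * c * (\<nu> / \<mu>) ^ N < 1"
    unfolding eventually_sequentially by blast
  \<comment> \<open>\<open>N > 0\<close> ensures that the truncated series contains its term for k =
    0, the all-ones vector, which makes it positive.\<close>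
  then obtain N where N: "of_nat m * c * (\<nu> / \<mu>) ^ N < 1" "N > 0"
    by (metis le_SucI order_refl zero_less_Suc)
  have xN: "x N i / \<mu> ^ N \<le> 1" if "i < m" for i
  proof -
    have "x N i \<le> (\<Sum>j<m. c * \<nu> ^ N)"
      unfolding x_def using c that by (intro sum_mono) (fastforce intro: order_trans[OF abs_ge_self])
    then have "x N i / \<mu> ^ N \<le> (of_nat m * c * \<nu> ^ N) / \<mu> ^ N"
      using pos by (intro divide_right_mono) auto
    with N(1) show ?thesis by (simp add: power_divide)
  qed
  define u where "u i = (\<Sum>k<N. x k i / \<mu> ^ k)" for i
  show thesis
  proof (rule that[of u])
    fix i assume i: "i < m"
    have "x 0 i / \<mu> ^ 0 \<le> u i"
      unfolding u_def using N(2) x_nonneg[OF i] pos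
      by (intro member_le_sum[of 0 _ "\<lambda>k. x k i / \<mu> ^ k"]) auto
    then show "u i > 0" using x0[OF i] by simp
    \<comment> \<open>Applying W shifts the series by one index: up to the factor \<mu>, it gains
      the term of index \<open>N\<close>, which is at most 1, and loses the term of index 0, which
      equals 1.\<close>
    have "(\<Sum>j<m. W $$ (i,j) * u j) = (\<Sum>k<N. x (Suc k) i / \<mu> ^ k)"
      unfolding u_def sum_distrib_left xSuc[OF i] sum_divide_distrib by (subst sum.swap) simp
    also have "\<dots> = \<mu> * (\<Sum>k<N. x (Suc k) i / \<mu> ^ Suc k)"
      unfolding sum_distrib_left using pos by (intro sum.cong) auto
    also have "(\<Sum>k<N. x (Suc k) i / \<mu> ^ Suc k) = u i + x N i / \<mu> ^ N - x 0 i / \<mu> ^ 0"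
      using sum.lessThan_Suc_shift[of "\<lambda>k. x k i / \<mu> ^ k" N] by (simp add: u_def)
    also have "\<dots> \<le> u i" using xN[OF i] x0[OF i] by simp
    finally show "(\<Sum>j<m. W $$ (i,j) * u j) \<le> \<mu> * u i" using pos by simp
  qed
qed

text \<open>Take an eigenvector for an eigenvalue of maximal modulus and the least multiple of
  \<open>u\<close> that dominates its absolute values. In a row where the two agree, the eigenvalue
  equation and the triangle inequality bound the modulus by \<mu>.\<close>

lemma real_spectral_radius_le_of_subinvariant:
  fixes W :: "real mat" and u :: "nat \<Rightarrow> real"
  assumes W: "W \<in> carrier_mat m m" and m: "m > 0"
    and nonneg: "\<And>i j. i < m \<Longrightarrow> j < m \<Longrightarrow> W $$ (i,j) \<ge> 0"
    and u_pos: "\<And>i. i < m \<Longrightarrow> u i > 0"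
    and sub: "\<And>i. i < m \<Longrightarrow> (\<Sum>j<m. W $$ (i,j) * u j) \<le> \<mu> * u i"
  shows "real_spectral_radius W \<le> \<mu>"
proof -
  let ?V = "map_mat complex_of_real W"
  have V: "?V \<in> carrier_mat m m" using W by simp
  obtain k v where v: "eigenvector ?V v k" and sr: "real_spectral_radius W = norm k"
    using spectral_radius_mem_max(1)[OF V m]
    unfolding spectrum_def eigenvalue_def real_spectral_radius_def by auto
  have vm: "v \<in> carrier_vec m" "v \<noteq> 0\<^sub>v m" using v V unfolding eigenvector_def by auto
  then obtain i0 where i0: "i0 < m" "v $ i0 \<noteq> 0" by (metis carrier_vecD eq_vecI index_zero_vec)
  define t where "t = Max ((\<lambda>i. norm (v $ i) / u i) ` {..<m})"
  have fin: "finite ((\<lambda>i. norm (v $ i) / u i) ` {..<m})" by simp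
  have le_t: "norm (v $ i) \<le> t * u i" if "i < m" for i
  proof -
    have "norm (v $ i) / u i \<le> t" unfolding t_def using that by (intro Max_ge[OF fin]) auto
    then show ?thesis using u_pos[OF that] by (simp add: divide_le_eq)
  qed
  have "t \<in> (\<lambda>i. norm (v $ i) / u i) ` {..<m}" unfolding t_def using m by (intro Max_in[OF fin]) auto
  then obtain i where i: "i < m" "t = norm (v $ i) / u i" by auto
  \<comment> \<open>A nonzero entry of the eigenvector forces \<open>t\<close> to be positive, so
    \<open>t * u i\<close> can be cancelled at the end.\<close>
  have "0 < t * u i0" using le_t[OF i0(1)] i0(2) by (meson less_le_trans zero_less_norm_iff)
  then have t: "t > 0" using u_pos[OF i0(1)] by (simp add: zero_less_mult_iff)
  have vi: "norm (v $ i) = t * u i" using i u_pos[OF i(1)] by simp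
  have "norm k * (t * u i) = norm (k * v $ i)" by (simp add: norm_mult vi)
  also have "\<dots> = norm (\<Sum>j<m. ?V $$ (i,j) * v $ j)"
    using eigenvector_index[OF V v i(1)] by simp
  also have "\<dots> \<le> (\<Sum>j<m. norm (?V $$ (i,j) * v $ j))" by (rule norm_sum)
  also have "\<dots> \<le> (\<Sum>j<m. W $$ (i,j) * (t * u j))"
  proof (rule sum_mono)
    fix j assume "j \<in> {..<m}"
    then have j: "j < m" by simp
    have "norm (?V $$ (i,j) * v $ j) = W $$ (i,j) * norm (v $ j)"
      using W i(1) j nonneg by (simp add: norm_mult)
    then show "norm (?V $$ (i,j) * v $ j) \<le> W $$ (i,j) * (t * u j)"
      using nonneg[OF i(1) j] le_t[OF j] by (simp add: mult_left_mono)
  qed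
  also have "\<dots> = t * (\<Sum>j<m. W $$ (i,j) * u j)" by (simp add: sum_distrib_left ac_simps)
  also have "\<dots> \<le> t * (\<mu> * u i)" using sub[OF i(1)] t by (intro mult_left_mono) auto
  finally have "norm k * (t * u i) \<le> \<mu> * (t * u i)" by (simp add: ac_simps)
  moreover have "t * u i > 0" using t u_pos[OF i(1)] by simp
  ultimately show ?thesis unfolding sr by (rule mult_right_le_imp_le)
qed

section \<open>Comparison of block companion matrices\<close>

lemma sum_lessThan_add:
  fixes f :: "nat \<Rightarrow> 'a :: comm_monoid_add"
  shows "(\<Sum>j<n + m. f j) = (\<Sum>j<n. f j) + (\<Sum>j<m. f (n + j))"
  by (induction m) (auto simp: add.assoc)

lemma companion_row_sum:
  fixes B C :: "real mat"
  assumes B: "B \<in> carrier_mat n n" and C: "C \<in> carrier_mat n n" and i: "i < n"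
  defines "W \<equiv> four_block_mat B C (1\<^sub>m n) (0\<^sub>m n n)"
  shows "(\<Sum>j<n + n. W $$ (i,j) * u j) = (\<Sum>j<n. B $$ (i,j) * u j + C $$ (i,j) * u (n + j))"
    and "(\<Sum>j<n + n. W $$ (n + i,j) * u j) = u i"
proof -
  show "(\<Sum>j<n + n. W $$ (i,j) * u j) = (\<Sum>j<n. B $$ (i,j) * u j + C $$ (i,j) * u (n + j))"
    unfolding sum_lessThan_add sum.distrib
    using B C i by (intro arg_cong2[of _ _ _ _ "(+)"] sum.cong) (auto simp: W_def)
  have "(\<Sum>j<n + n. W $$ (n + i,j) * u j) = (\<Sum>j<n. if i = j then u j else 0) + (\<Sum>j<n. 0)"
    unfolding sum_lessThan_add
    using B C i by (intro arg_cong2[of _ _ _ _ "(+)"] sum.cong) (auto simp: W_def)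
  then show "(\<Sum>j<n + n. W $$ (n + i,j) * u j) = u i"
    using i by simp
qed

lemma companion_nonneg:
  fixes B C :: "real mat"
  assumes "B \<in> carrier_mat n n" "C \<in> carrier_mat n n"
    and "\<And>i j. i < n \<Longrightarrow> j < n \<Longrightarrow> B $$ (i,j) \<ge> 0"
    and "\<And>i j. i < n \<Longrightarrow> j < n \<Longrightarrow> C $$ (i,j) \<ge> 0"
    and "i < n + n" "j < n + n"
  shows "four_block_mat B C (1\<^sub>m n) (0\<^sub>m n n) $$ (i,j) \<ge> 0"
  using assms by auto

lemma real_spectral_radius_companion_mono:
  fixes n :: nat and B\<^sub>1 C\<^sub>1 B\<^sub>2 C\<^sub>2 :: "real mat"
  defines "W\<^sub>1 \<equiv> four_block_mat B\<^sub>1 C\<^sub>1 (1\<^sub>m n) (0\<^sub>m n n)"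
    and "W\<^sub>2 \<equiv> four_block_mat B\<^sub>2 C\<^sub>2 (1\<^sub>m n) (0\<^sub>m n n)"
  assumes carrier: "B\<^sub>1 \<in> carrier_mat n n" "C\<^sub>1 \<in> carrier_mat n n"
      "B\<^sub>2 \<in> carrier_mat n n" "C\<^sub>2 \<in> carrier_mat n n"
    and nonneg1: "\<And>i j. i < n \<Longrightarrow> j < n \<Longrightarrow> B\<^sub>1 $$ (i,j) \<ge> 0"
      "\<And>i j. i < n \<Longrightarrow> j < n \<Longrightarrow> C\<^sub>1 $$ (i,j) \<ge> 0"
    and nonneg2: "\<And>i j. i < n \<Longrightarrow> j < n \<Longrightarrow> B\<^sub>2 $$ (i,j) \<ge> 0"
      "\<And>i j. i < n \<Longrightarrow> j < n \<Longrightarrow> C\<^sub>2 $$ (i,j) \<ge> 0"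
    and le_B: "\<And>i j. i < n \<Longrightarrow> j < n \<Longrightarrow> B\<^sub>2 $$ (i,j) \<le> B\<^sub>1 $$ (i,j)"
    and le_BC: "\<And>i j. i < n \<Longrightarrow> j < n \<Longrightarrow>
      B\<^sub>1 $$ (i,j) + C\<^sub>1 $$ (i,j) \<le> B\<^sub>2 $$ (i,j) + C\<^sub>2 $$ (i,j)"
    and less_1: "real_spectral_radius W\<^sub>2 < 1"
  shows "real_spectral_radius W\<^sub>1 \<le> real_spectral_radius W\<^sub>2"
proof -
  have W: "W\<^sub>1 \<in> carrier_mat (n + n) (n + n)" "W\<^sub>2 \<in> carrier_mat (n + n) (n + n)"
    using carrier by (auto simp: W\<^sub>1_def W\<^sub>2_def)
  show ?thesis
  proof (cases "n = 0")
    case True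
    with W show ?thesis using real_spectral_radius_cong_0[of W\<^sub>1 W\<^sub>2] by simp
  next
    case False
    then have n: "n + n > 0" by simp
    show ?thesis
    \<comment> \<open>It suffices to bound the first radius by every \<mu> strictly between the
      second radius and 1: the lower bound provides the positive vector, the upper one the
      comparison of the blocks.\<close>
    proof (rule dense_ge_bounded[OF less_1])
      fix \<mu> assume \<mu>: "real_spectral_radius W\<^sub>2 < \<mu>" "\<mu> < 1"
      have "real_spectral_radius W\<^sub>2 \<ge> 0"
        unfolding real_spectral_radius_def using W n
        by (intro spectral_radius_nonneg[of _ "n + n"]) auto
      with \<mu> have \<mu>_pos: "\<mu> > 0" by simp
      obtain u where u_pos: "\<And>i. i < n + n \<Longrightarrow> u i > 0"
        and u: "\<And>i. i < n + n \<Longrightarrow> (\<Sum>j<n + n. W\<^sub>2 $$ (i,j) * u j) \<le> \<mu> * u i"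
        using positive_subinvariant_vector_exists[OF W(2) n _ \<mu>(1)]
          companion_nonneg[OF carrier(3,4) nonneg2] unfolding W\<^sub>2_def by blast
      \<comment> \<open>The two block rows of the subinvariance are read off separately; the lower
        one is what eliminates the second half of \<open>u\<close>.\<close>
      have low: "u j \<le> \<mu> * u (n + j)" if "j < n" for j
        using u[of "n + j"] companion_row_sum(2)[OF carrier(3,4) that] that unfolding W\<^sub>2_def by simp
      have up: "(\<Sum>j<n. B\<^sub>2 $$ (i,j) * u j + C\<^sub>2 $$ (i,j) * u (n + j)) \<le> \<mu> * u i" if "i < n" for i
        using u[of i] companion_row_sum(1)[OF carrier(3,4) that] that unfolding W\<^sub>2_def by simp
      \<comment> \<open>With this choice the lower block row for \<open>W\<^sub>1\<close> holds with
        equality, so only the upper one needs an estimate.\<close>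
      define w where "w i = (if i < n then \<mu> * u i else u (i - n))" for i
      show "real_spectral_radius W\<^sub>1 \<le> \<mu>"
      proof (rule real_spectral_radius_le_of_subinvariant[OF W(1) n, of w])
        show "W\<^sub>1 $$ (i,j) \<ge> 0" if "i < n + n" "j < n + n" for i j
          using companion_nonneg[OF carrier(1,2) nonneg1 that] unfolding W\<^sub>1_def .
        show "w i > 0" if "i < n + n" for i
          using u_pos[of i] u_pos[of "i - n"] that \<mu>_pos by (auto simp: w_def)
        fix i assume i2: "i < n + n"
        show "(\<Sum>j<n + n. W\<^sub>1 $$ (i,j) * w j) \<le> \<mu> * w i"
        proof (cases "i < n")
          case True
          have "B\<^sub>1 $$ (i,j) * (\<mu> * u j) + C\<^sub>1 $$ (i,j) * u j
              \<le> \<mu> * (B\<^sub>2 $$ (i,j) * u j + C\<^sub>2 $$ (i,j) * u (n + j))" if j: "j < n" for j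
          proof -
            \<comment> \<open>Here \<mu> B + C = (B + C) - (1 - \<mu>) B; passing from index 1 to
              index 2 increases B + C and decreases B, and 1 - \<mu> is positive.\<close>
            have "(1 - \<mu>) * B\<^sub>2 $$ (i,j) \<le> (1 - \<mu>) * B\<^sub>1 $$ (i,j)"
              using \<mu>(2) le_B[OF True j] by (intro mult_left_mono) auto
            then have "\<mu> * B\<^sub>1 $$ (i,j) + C\<^sub>1 $$ (i,j) \<le> \<mu> * B\<^sub>2 $$ (i,j) + C\<^sub>2 $$ (i,j)"
              using le_BC[OF True j] by (simp add: algebra_simps)
            then have "(\<mu> * B\<^sub>1 $$ (i,j) + C\<^sub>1 $$ (i,j)) * u j
                \<le> (\<mu> * B\<^sub>2 $$ (i,j) + C\<^sub>2 $$ (i,j)) * u j"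
              using u_pos[of j] j by (intro mult_right_mono) auto
            moreover have "C\<^sub>2 $$ (i,j) * u j \<le> C\<^sub>2 $$ (i,j) * (\<mu> * u (n + j))"
              using low[OF j] nonneg2(2)[OF True j] by (rule mult_left_mono)
            ultimately show ?thesis by (simp add: algebra_simps)
          qed
          then have "(\<Sum>j<n. B\<^sub>1 $$ (i,j) * (\<mu> * u j) + C\<^sub>1 $$ (i,j) * u j)
              \<le> \<mu> * (\<Sum>j<n. B\<^sub>2 $$ (i,j) * u j + C\<^sub>2 $$ (i,j) * u (n + j))"
            unfolding sum_distrib_left by (intro sum_mono) simp
          also have "\<dots> \<le> \<mu> * (\<mu> * u i)"
            using up[OF True] \<mu>_pos by (intro mult_left_mono) auto
          finally show ?thesis
            unfolding W\<^sub>1_def companion_row_sum(1)[OF carrier(1,2) True]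
            using True by (simp add: w_def)
        next
          case False
          then obtain l where l: "i = n + l" "l < n"
            using i2 by (metis add_less_cancel_left le_add_diff_inverse not_less)
          then show ?thesis
            unfolding W\<^sub>1_def l(1) companion_row_sum(2)[OF carrier(1,2) l(2)]
            by (simp add: w_def)
        qed
      qed
    qed
  qed
qed

text \<open>Multiplying A = P - R + S on the right by the inverse of P turns its first term into the
  identity. This translates the hypothesis on the products of \<open>A\<^sub>i\<close> with the
  inverse of \<open>P\<^sub>i\<close> into one on the blocks of the iteration matrices.\<close>

lemma splitting_times_inverse_index:
  assumes split: "double_weak_splitting_II n A P R S" and ij: "i < n" "j < n"
  shows "(A * inverse_mat P) $$ (i,j)
    = (if i = j then 1 else 0) - (R * inverse_mat P) $$ (i,j) + (S * inverse_mat P) $$ (i,j)"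
proof -
  have P: "P \<in> carrier_mat n n" "invertible_mat P" and RS: "R \<in> carrier_mat n n" "S \<in> carrier_mat n n"
    and A: "A = P - R + S"
    using split unfolding double_weak_splitting_II_def by auto
  note Q = inverse_mat[OF P]
  have "A * inverse_mat P = P * inverse_mat P - R * inverse_mat P + S * inverse_mat P"
    unfolding A using P RS Q(1)
    by (simp add: add_mult_distrib_mat[of _ n n _ _ n] minus_mult_distrib_mat[of _ n n _ _ n]
        minus_carrier_mat)
  then show ?thesis using Q P RS ij by simp
qed

theorem theorem3p16:
  fixes n :: nat
    and A\<^sub>1 P\<^sub>1 R\<^sub>1 S\<^sub>1 A\<^sub>2 P\<^sub>2 R\<^sub>2 S\<^sub>2 W\<^sub>1 W\<^sub>2 :: "real mat"
  assumes "A\<^sub>1 \<in> carrier_mat n n" and "symmetric_mat A\<^sub>1" and "invertible_mat A\<^sub>1"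
    and "A\<^sub>2 \<in> carrier_mat n n" and "symmetric_mat A\<^sub>2" and "invertible_mat A\<^sub>2"
    and "convergent_double_weak_splitting_II n A\<^sub>1 P\<^sub>1 R\<^sub>1 S\<^sub>1"
    and "convergent_double_weak_splitting_II n A\<^sub>2 P\<^sub>2 R\<^sub>2 S\<^sub>2"
    and "W\<^sub>1 = double_iteration_mat n P\<^sub>1 R\<^sub>1 S\<^sub>1"
    and "W\<^sub>2 = double_iteration_mat n P\<^sub>2 R\<^sub>2 S\<^sub>2"
    and "R\<^sub>1 * inverse_mat P\<^sub>1 \<ge> R\<^sub>2 * inverse_mat P\<^sub>2"
    and "A\<^sub>1 * inverse_mat P\<^sub>1 \<ge> A\<^sub>2 * inverse_mat P\<^sub>2"
  shows "real_spectral_radius W\<^sub>1 \<le> real_spectral_radius W\<^sub>2 \<and> real_spectral_radius W\<^sub>2 < 1"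
proof -
  have split: "double_weak_splitting_II n A\<^sub>1 P\<^sub>1 R\<^sub>1 S\<^sub>1" "double_weak_splitting_II n A\<^sub>2 P\<^sub>2 R\<^sub>2 S\<^sub>2"
    and less_1: "real_spectral_radius W\<^sub>2 < 1"
    using assms(7,8,10) unfolding convergent_double_weak_splitting_II_def by auto
  have P: "P\<^sub>1 \<in> carrier_mat n n" "invertible_mat P\<^sub>1" "P\<^sub>2 \<in> carrier_mat n n" "invertible_mat P\<^sub>2"
    and RS: "R\<^sub>1 \<in> carrier_mat n n" "S\<^sub>1 \<in> carrier_mat n n" "R\<^sub>2 \<in> carrier_mat n n" "S\<^sub>2 \<in> carrier_mat n n"
    using split unfolding double_weak_splitting_II_def by auto
  note Q = inverse_mat(1)[OF P(1,2)] inverse_mat(1)[OF P(3,4)]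
  have nonneg:
    "(R\<^sub>1 * inverse_mat P\<^sub>1) $$ (i,j) \<ge> 0" "(S\<^sub>1 * inverse_mat P\<^sub>1) $$ (i,j) \<le> 0"
    "(R\<^sub>2 * inverse_mat P\<^sub>2) $$ (i,j) \<ge> 0" "(S\<^sub>2 * inverse_mat P\<^sub>2) $$ (i,j) \<le> 0"
    if "i < n" "j < n" for i j
    using split Q RS that
    by (auto simp: double_weak_splitting_II_def less_eq_mat_def simp del: index_mult_mat(1))
  have le_R: "(R\<^sub>2 * inverse_mat P\<^sub>2) $$ (i,j) \<le> (R\<^sub>1 * inverse_mat P\<^sub>1) $$ (i,j)" if "i < n" "j < n" for i j
    using assms(11) Q RS that by (simp add: less_eq_mat_def del: index_mult_mat(1))
  have le_A: "(A\<^sub>2 * inverse_mat P\<^sub>2) $$ (i,j) \<le> (A\<^sub>1 * inverse_mat P\<^sub>1) $$ (i,j)" if "i < n" "j < n" for i j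
    using assms(1,4,12) Q that by (simp add: less_eq_mat_def del: index_mult_mat(1))
  have "real_spectral_radius W\<^sub>1 \<le> real_spectral_radius W\<^sub>2"
    unfolding assms(9,10) double_iteration_mat_def
  proof (rule real_spectral_radius_companion_mono)
    \<comment> \<open>The identity terms cancel and the signs reverse the inequality; the indices
      are swapped because the blocks are transposed.\<close>
    fix i j assume ij: "i < n" "j < n"
    show "(R\<^sub>1 * inverse_mat P\<^sub>1)\<^sup>T $$ (i,j) + (- (S\<^sub>1 * inverse_mat P\<^sub>1)\<^sup>T) $$ (i,j)
        \<le> (R\<^sub>2 * inverse_mat P\<^sub>2)\<^sup>T $$ (i,j) + (- (S\<^sub>2 * inverse_mat P\<^sub>2)\<^sup>T) $$ (i,j)"
      using le_A[OF ij(2,1)] Q RS ij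
      unfolding splitting_times_inverse_index[OF split(1) ij(2,1)]
        splitting_times_inverse_index[OF split(2) ij(2,1)]
      by (simp del: index_mult_mat(1))
  qed (use Q RS nonneg le_R less_1 in
      \<open>auto simp: assms(10) double_iteration_mat_def simp del: index_mult_mat(1)\<close>)
  with less_1 show ?thesis by simp
qed

end
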